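(* Take a finite-dimensional quantum system in the state $\rho(t)$ that evolves via a time-independent Hamiltonian with $d_E$ distinct energies. For any $\varepsilon>0$ and time $T>0$, the average distinguishability of $\rho(t)$ from $\omega$ over the interval $[0,T]$ using measurements in the finite set $\mathcal{M}$ is bounded by $$\left\langle D_{\mathcal{M}}(\rho(t),\omega)\right\rangle_T\le\frac{\mathcal{S}(\mathcal{M})}{4\sqrt{d_{\rm eff}}}\sqrt{\frac{5\pi}{2}N(\varepsilon)\left[\frac34+\frac1{\varepsilon T}\right]},$$ where $\mathcal{S}(\mathcal{M})$ is the number of measurement outcomes in $\mathcal{M}$, i.e. the sum of the numbers of outcomes of all measurements in $\mathcal{M}$.
   Context: The Hamiltonian is $H=\sum_{n=1}^{d_E}E_nP_n$ with distinct energies $E_n$ and $P_n$ the projector onto the eigenspace of energy $E_n$; $\rho(t)=e^{-iHt}\rho(0)e^{iHt}$ with $\rho(0)$ an arbitrary density operator. $\langle f(t)\rangle_T=\frac1T\int_0^Tf(t)\,dt$, and $\omega=\lim_{T\to\infty}\langle\rho(t)\rangle_T$ is the infinite-time average state. $d_{\rm eff}=1/\sum_n(\mathrm{tr}[P_n\rho(0)])^2$. For each pair $\alpha=(i,j)$ with $i\ne j$, $G_\alpha=E_i-E_j$, and $N(\varepsilon)=\max_E|\{\alpha:G_\alpha\in[E,E+\varepsilon)\}|$. $\mathcal{M}$ is a finite set of measurements, each measurement being a complete set of projectors $\{P_i\}$ (summing to the identity), one per outcome. The distinguishability with respect to $\mathcal{M}$ is $D_{\mathcal{M}}(\rho,\sigma)=\max_{\{P_i\}\in\mathcal{M}}\frac12\sum_i|\mathrm{tr}[P_i\rho]-\mathrm{tr}[P_i\sigma]|$.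 *)

theory Defs
  imports "HOL-Analysis.Analysis"
begin

text \<open>Operators on the Hilbert space \<open>complex ^ 'n\<close> are square matrices.\<close>

type_synonym 'n operator = "complex ^ 'n ^ 'n"

definition mat_scale :: "complex \<Rightarrow> 'n::finite operator \<Rightarrow> 'n operator" where
  "mat_scale c A = (\<chi> i j. c * A $ i $ j)"

definition mat_adjoint :: "'n::finite operator \<Rightarrow> 'n operator" where
  "mat_adjoint A = (\<chi> i j. cnj (A $ j $ i))"

text \<open>\<open>exp\<close> is not available on this type, because \<open>*\<close> on vectors is componentwise;
  \<open>((**) A ^^ k) (mat 1)\<close> is the \<open>k\<close>-th power of \<open>A\<close>.\<close>

definition mat_exp :: "'n::finite operator \<Rightarrow> 'n operator" where
  "mat_exp A = (\<Sum>k. (1 / fact k) *\<^sub>R ((**) A ^^ k) (mat 1))"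

definition density_operator :: "'n::finite operator \<Rightarrow> bool" where
  "density_operator \<rho> \<longleftrightarrow>
     mat_adjoint \<rho> = \<rho> \<and>
     (\<forall>v. 0 \<le> Re (\<Sum>i\<in>UNIV. cnj (v $ i) * (\<rho> *v v) $ i)) \<and>
     trace \<rho> = 1"

definition projector :: "'n::finite operator \<Rightarrow> bool" where
  "projector P \<longleftrightarrow> mat_adjoint P = P \<and> P ** P = P"

definition eigenspace :: "'n::finite operator \<Rightarrow> real \<Rightarrow> (complex ^ 'n) set" where
  "eigenspace H e = {v. H *v v = e *\<^sub>R v}"

definition energies :: "'n::finite operator \<Rightarrow> real set" where
  "energies H = {e. eigenspace H e \<noteq> {0}}"

text \<open>\<open>E 1, \<dots>, E d\<close> lists every energy exactly once. In particular the energy \<open>0\<close>, if it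
  occurs, cannot be left out, although it does not contribute to the sum. Self-adjointness of
  \<open>H\<close> follows from the last conjunct.\<close>

definition spectral_decomposition ::
  "'n::finite operator \<Rightarrow> nat \<Rightarrow> (nat \<Rightarrow> real) \<Rightarrow> (nat \<Rightarrow> 'n operator) \<Rightarrow> bool" where
  "spectral_decomposition H d E P \<longleftrightarrow>
     bij_betw E {1..d} (energies H) \<and>
     (\<forall>n\<in>{1..d}. projector (P n) \<and> range (\<lambda>v. P n *v v) = eigenspace H (E n)) \<and>
     H = (\<Sum>n=1..d. E n *\<^sub>R P n)"

definition evolved_state :: "'n::finite operator \<Rightarrow> 'n operator \<Rightarrow> real \<Rightarrow> 'n operator" where
  "evolved_state H \<rho>0 t =
     mat_exp (mat_scale (- \<i> * of_real t) H) ** \<rho>0 ** mat_exp (mat_scale (\<i> * of_real t) H)"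

definition time_average :: "real \<Rightarrow> (real \<Rightarrow> 'a::real_normed_vector) \<Rightarrow> 'a" where
  "time_average T f = (1 / T) *\<^sub>R integral {0..T} f"

definition equilibrium_state :: "'n::finite operator \<Rightarrow> 'n operator \<Rightarrow> 'n operator" where
  "equilibrium_state H \<rho>0 = Lim at_top (\<lambda>T. time_average T (evolved_state H \<rho>0))"

text \<open>The traces below are real, so \<open>Re\<close> discards nothing.\<close>

definition effective_dimension :: "nat \<Rightarrow> (nat \<Rightarrow> 'n::finite operator) \<Rightarrow> 'n operator \<Rightarrow> real" where
  "effective_dimension d P \<rho>0 = 1 / (\<Sum>n=1..d. (Re (trace (P n ** \<rho>0)))\<^sup>2)"

text \<open>Gaps are counted with multiplicity: by index pairs, not by values. The maximum is over
  all real \<open>x\<close>, but only finitely many cardinalities occur.\<close>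

definition gap_count :: "nat \<Rightarrow> (nat \<Rightarrow> real) \<Rightarrow> real \<Rightarrow> nat" where
  "gap_count d E \<epsilon> =
     Max (range (\<lambda>x::real. card {(i, j). i \<in> {1..d} \<and> j \<in> {1..d} \<and> i \<noteq> j \<and>
                                         E i - E j \<in> {x..<x + \<epsilon>}}))"

text \<open>A measurement is given as a list of projectors, one entry per outcome, so that several
  outcomes may have the zero projector.\<close>

definition measurement :: "'n::finite operator list \<Rightarrow> bool" where
  "measurement Ps \<longleftrightarrow> (\<forall>P\<in>set Ps. projector P) \<and> sum_list Ps = mat 1"

definition distinguishability ::
  "'n::finite operator list set \<Rightarrow> 'n operator \<Rightarrow> 'n operator \<Rightarrow> real" where
  "distinguishability M \<rho> \<sigma> =
     Max ((\<lambda>Ps. 1 / 2 * (\<Sum>P\<leftarrow>Ps. cmod (trace (P ** \<rho>) - trace (P ** \<sigma>)))) ` M)"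

definition outcome_count :: "'n::finite operator list set \<Rightarrow> nat" where
  "outcome_count M = (\<Sum>Ps\<in>M. length Ps)"

end

theory Submission
  imports Defs
begin

text \<open>For one projector \<open>Q\<close> the deviation \<open>tr (Q \<rho>(t)) - tr (Q \<omega>)\<close> is a trigonometric polynomial whose
  frequencies are the gaps \<open>E i - E j\<close> and whose amplitudes are \<open>tr (Q P\<^sub>j \<rho>(0) P\<^sub>i)\<close>. Its mean square over
  \<open>[0, T]\<close> is at most \<open>1 / T\<close> times the integral of its square against
  \<open>(5 / 4) * exp (- c * \<bar>t - T / 2\<bar>)\<close> with \<open>c = 4 / (9 * T)\<close>; here \<open>exp (c * T / 2) \<le> 5 / 4\<close>, and \<open>\<pi> \<ge> 3\<close>
  turns the resulting constant \<open>45 / 8\<close> into \<open>(5 * \<pi> / 2) * (3 / 4)\<close>. The Fourier transform of this weight is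
  a Lorentzian, so the double sum over gaps is controlled by the Lorentzian row sums, which a layer-cake
  estimate bounds by \<open>(2 / c) * N(\<epsilon>) * (1 + \<pi> * c / \<epsilon>)\<close>. The sum of the squared amplitudes is at most
  \<open>1 / (4 * d\<^sub>e\<^sub>f\<^sub>f)\<close> by Bessel's inequality for the form \<open>tr (Y\<^sup>* X \<rho>(0))\<close>. The maximum over measurements
  is bounded by the sum over all outcomes, and the mean by the root mean square.\<close>

subsection \<open>Operators and the spectral decomposition\<close>

interpretation mat_mult: bounded_bilinear "(**) :: 'n::finite operator \<Rightarrow> 'n operator \<Rightarrow> 'n operator"
  by (subst bilinear_conv_bounded_bilinear[symmetric])
    (auto simp: bilinear_def matrix_matrix_mult_def vec_eq_iff algebra_simps sum.distrib scaleR_sum_right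
      intro!: linearI)

text \<open>Continuity in the scalar argument is what carries series, integrals and limits of scalar
  functions over to operators.\<close>

interpretation mat_scale: bounded_bilinear "mat_scale :: complex \<Rightarrow> 'n::finite operator \<Rightarrow> 'n operator"
  by (subst bilinear_conv_bounded_bilinear[symmetric])
    (auto simp: bilinear_def mat_scale_def vec_eq_iff algebra_simps intro!: linearI)

lemma linear_trace: "linear (trace :: 'n::finite operator \<Rightarrow> complex)"
  by (auto simp: trace_def algebra_simps sum.distrib scaleR_sum_right intro!: linearI)

lemma linear_mat_adjoint: "linear (mat_adjoint :: 'n::finite operator \<Rightarrow> 'n operator)"
  by (auto simp: mat_adjoint_def vec_eq_iff intro!: linearI)

lemma mat_scale_mult_left: "mat_scale a A ** B = mat_scale a (A ** B)"
  by (simp add: mat_scale_def matrix_matrix_mult_def vec_eq_iff sum_distrib_left mult.assoc)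

lemma mat_scale_mult_right: "A ** mat_scale a B = mat_scale a (A ** B)"
  by (simp add: mat_scale_def matrix_matrix_mult_def vec_eq_iff sum_distrib_left mult_ac)

lemma mat_scale_scale: "mat_scale a (mat_scale b A) = mat_scale (a * b) A"
  by (simp add: mat_scale_def vec_eq_iff)

lemma mat_scale_one: "mat_scale 1 A = A"
  by (simp add: mat_scale_def vec_eq_iff)

lemma scaleR_eq_mat_scale: "r *\<^sub>R A = mat_scale (complex_of_real r) A"
  by (simp add: mat_scale_def vec_eq_iff) (simp add: scaleR_conv_of_real)

lemma trace_mat_scale: "trace (mat_scale a A) = a * trace A"
  by (simp add: mat_scale_def trace_def sum_distrib_left)

lemma mat_adjoint_mult: "mat_adjoint (A ** B) = mat_adjoint B ** mat_adjoint A"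
  by (simp add: mat_adjoint_def matrix_matrix_mult_def vec_eq_iff mult.commute)

lemma mat_adjoint_mat_scale: "mat_adjoint (mat_scale a A) = mat_scale (cnj a) (mat_adjoint A)"
  by (simp add: mat_adjoint_def mat_scale_def vec_eq_iff)

lemma trace_mat_adjoint: "trace (mat_adjoint A) = cnj (trace A)"
  by (simp add: mat_adjoint_def trace_def)

lemma mat_adjoint_mat_1: "mat_adjoint (mat 1) = mat 1"
  by (simp add: mat_adjoint_def mat_def vec_eq_iff)

lemma matrix_eqI_mult_vec:
  fixes A B :: "'n::finite operator"
  assumes "\<And>v. A *v v = B *v v"
  shows "A = B"
  using assms by (simp add: matrix_eq)

section \<open>Orthogonality and completeness of the spectral projectors\<close>

lemma spectral_decompositionD:
  assumes "spectral_decomposition H d E P"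
  shows "inj_on E {1..d}" and "E ` {1..d} = energies H" and "H = (\<Sum>n=1..d. E n *\<^sub>R P n)"
    and "n \<in> {1..d} \<Longrightarrow> mat_adjoint (P n) = P n" and "n \<in> {1..d} \<Longrightarrow> P n ** P n = P n"
    and "n \<in> {1..d} \<Longrightarrow> range (\<lambda>v. P n *v v) = eigenspace H (E n)"
  using assms unfolding spectral_decomposition_def projector_def bij_betw_def by blast+

text \<open>\<open>H\<close> is self-adjoint as a real combination of the \<open>P n\<close>, so
  \<open>P m ** H ** P n\<close> can be evaluated from either side, giving \<open>E m\<close> and
  \<open>E n\<close> times \<open>P m ** P n\<close>; distinct energies force the product to
  vanish.\<close>

lemma spectral_decomposition_orthogonal:
  assumes sd: "spectral_decomposition H d E P" and "m \<in> {1..d}" "n \<in> {1..d}" "m \<noteq> n"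
  shows "P m ** P n = 0"
proof -
  note adj = spectral_decompositionD(4)[OF sd]
  note H = spectral_decompositionD(3)[OF sd]
  have adjH: "mat_adjoint H = H"
    by (subst (1 2) H) (simp add: linear_sum[OF linear_mat_adjoint] linear_scale[OF linear_mat_adjoint] adj)
  have HP: "H ** P k = E k *\<^sub>R P k" if "k \<in> {1..d}" for k
  proof (rule matrix_eqI_mult_vec)
    fix v
    have "P k *v v \<in> eigenspace H (E k)"
      using spectral_decompositionD(6)[OF sd that] by blast
    then have "H *v (P k *v v) = E k *\<^sub>R (P k *v v)"
      by (simp add: eigenspace_def)
    then show "(H ** P k) *v v = (E k *\<^sub>R P k) *v v"
      by (simp only: matrix_vector_mul_assoc[symmetric])
        (simp add: matrix_vector_mult_def vec_eq_iff scaleR_sum_right)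
  qed
  have PH: "P m ** H = E m *\<^sub>R P m"
    using arg_cong[OF HP[OF assms(2)], of mat_adjoint] assms
    by (simp add: mat_adjoint_mult adj adjH linear_scale[OF linear_mat_adjoint])
  have "E m *\<^sub>R (P m ** P n) = (P m ** H) ** P n"
    by (simp add: PH mat_mult.scaleR_left)
  also have "\<dots> = P m ** (H ** P n)"
    by (simp add: matrix_mul_assoc)
  also have "\<dots> = E n *\<^sub>R (P m ** P n)"
    using assms by (simp add: HP mat_mult.scaleR_right)
  finally have "(E m - E n) *\<^sub>R (P m ** P n) = 0"
    by (simp add: algebra_simps)
  moreover have "E m \<noteq> E n"
    using inj_on_eq_iff[OF spectral_decompositionD(1)[OF sd] assms(2,3)] assms(4) by simp
  ultimately show ?thesis by simp
qed

lemma spectral_decomposition_mult: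
  assumes "spectral_decomposition H d E P" and "m \<in> {1..d}" "n \<in> {1..d}"
  shows "P m ** P n = (if m = n then P n else 0)"
  using spectral_decomposition_orthogonal[OF assms] spectral_decompositionD(5)[OF assms(1,3)] by auto

text \<open>The complement \<open>Q\<close> of the projectors satisfies \<open>H Q = 0\<close>, so its range would be an eigenspace of
  energy \<open>0\<close>, which the decomposition already contains.\<close>

lemma spectral_decomposition_sum:
  assumes sd: "spectral_decomposition H d E P"
  shows "(\<Sum>n=1..d. P n) = mat 1"
proof (rule ccontr)
  define Q where "Q = mat 1 - (\<Sum>n=1..d. P n)"
  assume "(\<Sum>n=1..d. P n) \<noteq> mat 1"
  then have "Q \<noteq> 0" by (simp add: Q_def)
  have PQ: "P m ** Q = 0" if "m \<in> {1..d}" for m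
    using that
    by (simp add: Q_def mat_mult.diff_right mat_mult.sum_right
        spectral_decomposition_mult[OF sd] matrix_mul_rid)
  have "H ** Q = 0"
    by (subst spectral_decompositionD(3)[OF sd]) (simp add: mat_mult.sum_left mat_mult.scaleR_left PQ)
  then have HQ: "Q *v v \<in> eigenspace H 0" for v
    by (simp add: eigenspace_def matrix_vector_mul_assoc)
  obtain v where v: "Q *v v \<noteq> 0"
    using \<open>Q \<noteq> 0\<close> matrix_eq[of Q 0] by auto
  \<comment> \<open>Hence some \<open>P m\<close> projects onto the kernel of \<open>H\<close>. It
    fixes \<open>Q *v v\<close>, yet annihilates it by \<open>PQ\<close>.\<close>
  have "0 \<in> energies H"
    using HQ[of v] v by (auto simp: energies_def)
  then obtain m where m: "m \<in> {1..d}" "E m = 0"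
    using spectral_decompositionD(2)[OF sd] by (metis imageE)
  obtain w where w: "Q *v v = P m *v w"
    using HQ[of v] spectral_decompositionD(6)[OF sd m(1)] m(2) by (metis imageE)
  have "P m *v (Q *v v) = Q *v v"
    using spectral_decomposition_mult[OF sd m(1) m(1)]
    by (simp only: w matrix_vector_mul_assoc) simp
  then show False
    using v by (simp add: matrix_vector_mul_assoc PQ[OF m(1)])
qed

section \<open>Spectral form of the evolution\<close>

text \<open>Orthogonality lets the power series act on each energy separately; the zeroth power is
  where completeness of the projectors enters.\<close>

lemma mat_exp_spectral:
  assumes sd: "spectral_decomposition H d E P"
  shows "mat_exp (mat_scale z H) = (\<Sum>n=1..d. mat_scale (exp (z * E n)) (P n))"
proof -
  have H: "mat_scale z H = (\<Sum>n=1..d. mat_scale (z * E n) (P n))"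
    by (subst spectral_decompositionD(3)[OF sd])
      (simp add: mat_scale.sum_right scaleR_eq_mat_scale mat_scale_scale)
  have pow: "((**) (mat_scale z H) ^^ k) (mat 1) = (\<Sum>n=1..d. mat_scale ((z * E n) ^ k) (P n))" for k
  proof (induction k)
    case 0
    then show ?case using spectral_decomposition_sum[OF sd] by (simp add: mat_scale_one)
  next
    case (Suc k)
    have "((**) (mat_scale z H) ^^ Suc k) (mat 1) =
        (\<Sum>m=1..d. mat_scale (z * E m) (P m)) ** (\<Sum>n=1..d. mat_scale ((z * E n) ^ k) (P n))"
      by (simp only: funpow.simps comp_apply Suc) (simp only: H)
    also have "\<dots> = (\<Sum>n=1..d. \<Sum>m=1..d. if m = n then mat_scale ((z * E n) ^ Suc k) (P n) else 0)"
      unfolding mat_mult.sum_left mat_mult.sum_right mat_scale_mult_left mat_scale_mult_right mat_scale.sum_right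
        mat_scale_scale
      by (intro sum.cong refl) (auto simp: spectral_decomposition_mult[OF sd] mat_scale.zero_right mult_ac)
    finally show ?case by simp
  qed
  have "(\<lambda>k. (\<Sum>n=1..d. mat_scale ((z * E n) ^ k /\<^sub>R fact k) (P n))) sums
      (\<Sum>n=1..d. mat_scale (exp (z * E n)) (P n))"
    by (intro sums_sum bounded_linear.sums[OF mat_scale.bounded_linear_left] exp_converges)
  then show ?thesis
    unfolding mat_exp_def pow
    by (simp add: sums_iff scaleR_sum_right mat_scale.scaleR_left inverse_eq_divide)
qed

text \<open>The right exponential contributes the phase of \<open>E i\<close> and the left one that
  of \<open>- E j\<close>, so the block \<open>P j ** \<rho>0 ** P i\<close> rotates at exactly the
  gap of the pair \<open>(i, j)\<close>.\<close>

lemma evolved_state_spectral: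
  assumes sd: "spectral_decomposition H d E P"
  shows "evolved_state H \<rho>0 t =
    (\<Sum>(i, j)\<in>{1..d} \<times> {1..d}. mat_scale (cis ((E i - E j) * t)) (P j ** \<rho>0 ** P i))"
proof -
  let ?e = "\<lambda>z n. exp (z * complex_of_real t * complex_of_real (E n))"
  have *: "?e \<i> i * ?e (- \<i>) j = cis ((E i - E j) * t)" for i j
    by (simp add: cis_conv_exp exp_add[symmetric] algebra_simps)
  have "evolved_state H \<rho>0 t = (\<Sum>j=1..d. mat_scale (?e (- \<i>) j) (P j)) ** \<rho>0 ** (\<Sum>i=1..d. mat_scale (?e \<i> i) (P i))"
    unfolding evolved_state_def mat_exp_spectral[OF sd] ..
  also have "\<dots> = (\<Sum>i=1..d. \<Sum>j=1..d. mat_scale (?e \<i> i * ?e (- \<i>) j) (P j ** \<rho>0 ** P i))"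
    by (simp only: mat_mult.sum_left mat_mult.sum_right mat_scale_mult_left mat_scale_mult_right
        mat_scale_scale mat_scale.sum_right)
  finally show ?thesis
    by (simp only: * sum.cartesian_product)
qed

subsection \<open>Amplitudes of the gaps\<close>

text \<open>Follows from self-adjointness of \<open>\<rho>\<close> and cyclicity of the trace. It
  makes the populations real and the off-diagonal coefficients conjugate-symmetric.\<close>

lemma density_operator_trace_adjoint:
  assumes "density_operator \<rho>"
  shows "trace (mat_adjoint X ** \<rho>) = cnj (trace (X ** \<rho>))"
proof -
  have "mat_adjoint X ** \<rho> = mat_adjoint (\<rho> ** X)"
    using assms by (simp add: mat_adjoint_mult density_operator_def)
  then show ?thesis
    by (simp add: trace_mat_adjoint trace_mul_sym[of \<rho> X])
qed

text \<open>By cyclicity the trace is that of \<open>Y ** \<rho>\<close> times the adjoint of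
  \<open>Y\<close>, whose \<open>k\<close>-th diagonal entry is the quadratic form of
  \<open>\<rho>\<close> at the conjugated \<open>k\<close>-th row of \<open>Y\<close>.\<close>

lemma density_operator_trace_nonneg:
  assumes "density_operator \<rho>"
  shows "0 \<le> Re (trace (mat_adjoint Y ** Y ** \<rho>))"
proof -
  have "trace (mat_adjoint Y ** Y ** \<rho>) = trace (Y ** (\<rho> ** mat_adjoint Y))"
    using trace_mul_sym[of "mat_adjoint Y" "Y ** \<rho>"] by (simp add: matrix_mul_assoc)
  also have "\<dots> = (\<Sum>k\<in>UNIV. \<Sum>i\<in>UNIV. cnj ((\<chi> i. cnj (Y $ k $ i)) $ i) * (\<rho> *v (\<chi> i. cnj (Y $ k $ i))) $ i)"
    by (simp add: trace_def matrix_matrix_mult_def matrix_vector_mult_def mat_adjoint_def)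
  finally show ?thesis
    using assms by (simp only: Re_sum[of _ UNIV]) (rule sum_nonneg, simp only: density_operator_def Re_sum)
qed

text \<open>Bessel's inequality for the positive semidefinite form \<open>tr (Y\<^sup>* X \<rho>)\<close>, in which the projectors \<open>P n\<close> are
  pairwise orthogonal. Replacing \<open>p n\<close> by \<open>p n + \<delta>\<close> avoids dividing by \<open>0\<close>.\<close>

lemma sum_off_diagonal_bessel:
  fixes \<rho> U :: "'n::finite operator"
  assumes sd: "spectral_decomposition H d E P" and \<rho>: "density_operator \<rho>"
    and U: "mat_adjoint U = U" "U ** U = mat 1" and m: "m \<in> {1..d}" and "\<delta> > 0"
  shows "(\<Sum>n=1..d. (cmod (trace (P n ** U ** P m ** \<rho>)))\<^sup>2 / (Re (trace (P n ** \<rho>)) + \<delta>)) \<le> Re (trace (P m ** \<rho>))"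
proof -
  define p where "p n = Re (trace (P n ** \<rho>))" for n
  define c where "c n = trace (P n ** U ** P m ** \<rho>)" for n
  \<comment> \<open>Without \<open>\<delta>\<close> these are the coefficients of the projection of
    \<open>U ** P m\<close> onto the span of the \<open>P n\<close>: \<open>p n\<close> is the
    squared length of \<open>P n\<close> and \<open>c n\<close> its inner product with
    \<open>U ** P m\<close>. The residual is \<open>Y\<close> below.\<close>
  define s where "s n = c n / of_real (p n + \<delta>)" for n
  note adj = spectral_decompositionD(4)[OF sd]
  note tr_adj = density_operator_trace_adjoint[OF \<rho>]
  have p_nonneg: "p n \<ge> 0" if "n \<in> {1..d}" for n
    using density_operator_trace_nonneg[OF \<rho>, of "P n"] spectral_decompositionD(5)[OF sd that]
    by (simp add: adj[OF that] p_def)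
  have trP: "trace (P n ** \<rho>) = of_real (p n)" if "n \<in> {1..d}" for n
    using tr_adj[of "P n"] by (simp add: adj[OF that] p_def complex_eq_iff)
  have c_adj: "trace (P m ** U ** P n ** \<rho>) = cnj (c n)" if "n \<in> {1..d}" for n
    using tr_adj[of "P n ** U ** P m"]
    by (simp add: c_def mat_adjoint_mult adj[OF that] adj[OF m] U matrix_mul_assoc)
  define S S' where "S = (\<Sum>n=1..d. mat_scale (s n) (P n))" and "S' = (\<Sum>n=1..d. mat_scale (cnj (s n)) (P n))"
  define Y where "Y = U ** P m - S"
  have "mat_adjoint Y = P m ** U - S'"
    unfolding Y_def S_def S'_def linear_diff[OF linear_mat_adjoint] linear_sum[OF linear_mat_adjoint]
    by (simp add: mat_adjoint_mult mat_adjoint_mat_scale adj adj[OF m] U)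
  then have "mat_adjoint Y ** Y ** \<rho> = P m ** U ** (U ** P m) ** \<rho> - P m ** U ** S ** \<rho>
      - S' ** (U ** P m) ** \<rho> + S' ** S ** \<rho>"
    unfolding Y_def by (simp add: mat_mult.diff_left mat_mult.diff_right)
  also have "P m ** U ** S ** \<rho> = (\<Sum>n=1..d. mat_scale (s n) (P m ** U ** P n ** \<rho>))"
    unfolding S_def by (simp only: mat_mult.sum_left mat_mult.sum_right mat_scale_mult_left mat_scale_mult_right)
  also have "S' ** (U ** P m) ** \<rho> = (\<Sum>n=1..d. mat_scale (cnj (s n)) (P n ** (U ** P m) ** \<rho>))"
    unfolding S'_def by (simp only: mat_mult.sum_left mat_scale_mult_left)
  also have "S' ** S = (\<Sum>n=1..d. mat_scale (cnj (s n) * s n) (P n))"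
  proof -
    have "S' ** S =
      (\<Sum>n=1..d. \<Sum>k=1..d. if k = n then mat_scale (cnj (s n) * s n) (P n) else 0)"
      unfolding S_def S'_def mat_mult.sum_left mat_mult.sum_right mat_scale_mult_left mat_scale_mult_right
        mat_scale.sum_right mat_scale_scale
      by (intro sum.cong refl) (auto simp: spectral_decomposition_mult[OF sd] mat_scale.zero_right mult_ac)
    then show ?thesis by simp
  qed
  \<comment> \<open>As \<open>U\<close> is a self-adjoint involution, \<open>U ** P m\<close> has
    the same squared length as \<open>P m\<close>.\<close>
  also have "P m ** U ** (U ** P m) = P m"
  proof -
    have "P m ** U ** (U ** P m) = P m ** (U ** U) ** P m" by (simp only: matrix_mul_assoc)
    then show ?thesis by (simp add: U spectral_decompositionD(5)[OF sd m])
  qed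
  finally have "trace (mat_adjoint Y ** Y ** \<rho>) = of_real (p m) - (\<Sum>n=1..d. s n * cnj (c n))
      - (\<Sum>n=1..d. cnj (s n) * c n) + (\<Sum>n=1..d. cnj (s n) * s n * of_real (p n))"
    by (simp add: linear_diff[OF linear_trace] linear_add[OF linear_trace] linear_sum[OF linear_trace]
        trace_mat_scale mat_mult.sum_left mat_scale_mult_left trP[OF m] trP c_adj c_def matrix_mul_assoc)
  then have "Re (trace (mat_adjoint Y ** Y ** \<rho>)) =
      p m - (\<Sum>n=1..d. Re (s n * cnj (c n)) + Re (cnj (s n) * c n) - Re (cnj (s n) * s n * of_real (p n)))"
    unfolding sum.distrib sum_subtractf by (simp only: plus_complex.sel minus_complex.sel Re_sum Re_complex_of_real)
  also have "\<dots> \<le> p m - (\<Sum>n=1..d. (cmod (c n))\<^sup>2 / (p n + \<delta>))"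
  proof (intro diff_left_mono sum_mono)
    fix n assume n: "n \<in> {1..d}"
    define q where "q = p n + \<delta>"
    have q: "q > 0" "p n \<le> q" using p_nonneg[OF n] \<open>\<delta> > 0\<close> by (auto simp: q_def)
    have 1: "s n * cnj (c n) = of_real ((cmod (c n))\<^sup>2 / q)" "cnj (s n) * c n = of_real ((cmod (c n))\<^sup>2 / q)"
      "cnj (s n) * s n * of_real (p n) = of_real ((cmod (c n))\<^sup>2 / q * (p n / q))"
      by (simp_all add: s_def q_def[symmetric] complex_norm_square mult_ac del: of_real_power)
    \<comment> \<open>The summand to be bounded below equals
      \<open>|c n|^2 / q * (2 - p n / q)\<close>, so \<open>p n \<le> q\<close> suffices.\<close>
    have "(cmod (c n))\<^sup>2 / q * (p n / q) \<le> (cmod (c n))\<^sup>2 / q * 1"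
      using q by (intro mult_left_mono) auto
    then show "(cmod (c n))\<^sup>2 / (p n + \<delta>) \<le>
        Re (s n * cnj (c n)) + Re (cnj (s n) * c n) - Re (cnj (s n) * s n * of_real (p n))"
      unfolding 1 Re_complex_of_real q_def[symmetric] by simp
  qed
  finally show ?thesis
    using density_operator_trace_nonneg[OF \<rho>, of Y] by (simp add: p_def c_def)
qed

text \<open>A Schur test. Dividing by shifted populations turns the squares \<open>c m n\<close>
  into a symmetric nonnegative matrix \<open>D\<close> whose row sums are at most 1 by Bessel's
  inequality; then \<open>q m * q n\<close> is split into half squares, and \<open>\<delta>\<close>
  is sent to 0.\<close>

lemma sum_off_diagonal_le:
  fixes \<rho> U :: "'n::finite operator"
  assumes sd: "spectral_decomposition H d E P" and \<rho>: "density_operator \<rho>"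
    and U: "mat_adjoint U = U" "U ** U = mat 1"
  shows "(\<Sum>m=1..d. \<Sum>n=1..d. (cmod (trace (P n ** U ** P m ** \<rho>)))\<^sup>2) \<le> (\<Sum>n=1..d. (Re (trace (P n ** \<rho>)))\<^sup>2)"
proof -
  define p where "p n = Re (trace (P n ** \<rho>))" for n
  define c where "c m n = (cmod (trace (P n ** U ** P m ** \<rho>)))\<^sup>2" for m n
  note adj = spectral_decompositionD(4)[OF sd]
  have c_sym: "c m n = c n m" if "m \<in> {1..d}" "n \<in> {1..d}" for m n
  proof -
    have "trace (mat_adjoint (P n ** U ** P m) ** \<rho>) = cnj (trace (P n ** U ** P m ** \<rho>))"
      by (rule density_operator_trace_adjoint[OF \<rho>])
    then have "trace (P m ** U ** P n ** \<rho>) = cnj (trace (P n ** U ** P m ** \<rho>))"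
      by (simp add: mat_adjoint_mult adj[OF that(1)] adj[OF that(2)] U matrix_mul_assoc)
    then show ?thesis by (simp add: c_def)
  qed
  have p_nonneg: "p n \<ge> 0" if "n \<in> {1..d}" for n
    using density_operator_trace_nonneg[OF \<rho>, of "P n"] spectral_decompositionD(5)[OF sd that]
    by (simp add: adj[OF that] p_def)
  have le: "(\<Sum>m=1..d. \<Sum>n=1..d. c m n) \<le> (\<Sum>m=1..d. (p m + \<delta>)\<^sup>2)" if "\<delta> > 0" for \<delta>
  proof -
    define q where "q n = p n + \<delta>" for n
    have q: "q n > 0" if "n \<in> {1..d}" for n
      using p_nonneg[OF that] \<open>\<delta> > 0\<close> by (simp add: q_def)
    define D where "D m n = c m n / (q m * q n)" for m n
    have D_nonneg: "D m n \<ge> 0" if "m \<in> {1..d}" "n \<in> {1..d}" for m n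
      using q[OF that(1)] q[OF that(2)] by (simp add: D_def c_def)
    have row: "(\<Sum>n=1..d. D m n) \<le> 1" if "m \<in> {1..d}" for m
    proof -
      have "(\<Sum>n=1..d. D m n) = (\<Sum>n=1..d. c m n / q n) / q m"
        by (simp add: D_def sum_divide_distrib mult.commute)
      also have "\<dots> \<le> p m / q m"
        using sum_off_diagonal_bessel[OF sd \<rho> U that \<open>\<delta> > 0\<close>] q[OF that]
        by (intro divide_right_mono) (auto simp: c_def q_def p_def)
      also have "\<dots> \<le> 1" using q[OF that] \<open>\<delta> > 0\<close> by (simp add: q_def)
      finally show ?thesis .
    qed
    have "(\<Sum>m=1..d. \<Sum>n=1..d. c m n) \<le> (\<Sum>m=1..d. \<Sum>n=1..d. (q m)\<^sup>2 / 2 * D m n + (q n)\<^sup>2 / 2 * D m n)"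
    proof (intro sum_mono)
      fix m n assume mn: "m \<in> {1..d}" "n \<in> {1..d}"
      have "c m n = q m * q n * D m n"
        using q[OF mn(1)] q[OF mn(2)] by (simp add: D_def)
      also have "\<dots> \<le> ((q m)\<^sup>2 / 2 + (q n)\<^sup>2 / 2) * D m n"
        using sum_squares_bound[of "q m" "q n"] D_nonneg[OF mn] by (intro mult_right_mono) auto
      finally show "c m n \<le> (q m)\<^sup>2 / 2 * D m n + (q n)\<^sup>2 / 2 * D m n" by (simp add: distrib_right)
    qed
    \<comment> \<open>Symmetry of \<open>D\<close> makes the column half equal to the row
      half.\<close>
    also have "\<dots> = (\<Sum>m=1..d. (q m)\<^sup>2 * (\<Sum>n=1..d. D m n))"
    proof -
      have "(\<Sum>m=1..d. \<Sum>n=1..d. (q n)\<^sup>2 / 2 * D m n) = (\<Sum>m=1..d. \<Sum>n=1..d. (q m)\<^sup>2 / 2 * D m n)"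
        by (subst sum.swap) (intro sum.cong refl, simp add: D_def c_sym mult.commute)
      then have "(\<Sum>m=1..d. \<Sum>n=1..d. (q m)\<^sup>2 / 2 * D m n + (q n)\<^sup>2 / 2 * D m n) =
          2 * (\<Sum>m=1..d. \<Sum>n=1..d. (q m)\<^sup>2 / 2 * D m n)"
        by (simp only: sum.distrib)
      then show ?thesis
        by (simp add: sum_distrib_left)
    qed
    also have "\<dots> \<le> (\<Sum>m=1..d. (q m)\<^sup>2 * 1)"
      by (intro sum_mono mult_left_mono row) auto
    finally show ?thesis by (simp add: q_def)
  qed
  have "((\<lambda>\<delta>. \<Sum>m=1..d. (p m + \<delta>)\<^sup>2) \<longlongrightarrow> (\<Sum>m=1..d. (p m + 0)\<^sup>2)) (at_right 0)"
    by (intro tendsto_intros)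
  then have "(\<Sum>m=1..d. \<Sum>n=1..d. c m n) \<le> (\<Sum>m=1..d. (p m + 0)\<^sup>2)"
    by (rule tendsto_lowerbound) (use eventually_mono[OF eventually_at_right_less le] in auto)
  then show ?thesis by (simp add: p_def c_def)
qed

section \<open>The infinite-time average\<close>

text \<open>At nonzero frequency the integral of the oscillation has modulus at most
  \<open>2 / \<bar>\<nu>\<bar>\<close>, so dividing by \<open>T\<close> kills it.\<close>

lemma time_average_cis_tendsto:
  "((\<lambda>T. time_average T (\<lambda>t. cis (\<nu> * t))) \<longlongrightarrow> (if \<nu> = 0 then 1 else 0)) at_top"
proof (cases "\<nu> = 0")
  case True
  have "\<forall>\<^sub>F T in at_top. 1 = time_average T (\<lambda>t. cis (\<nu> * t))"
    using eventually_gt_at_top[of 0]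
    by (rule eventually_mono) (simp add: True time_average_def scaleR_conv_of_real)
  then show ?thesis
    using True by (auto intro: Lim_transform_eventually[OF tendsto_const])
next
  case False
  have "norm (time_average T (\<lambda>t. cis (\<nu> * t))) \<le> (2 / \<bar>\<nu>\<bar>) / T" if T: "T > 0" for T
  proof -
    let ?F = "\<lambda>z. exp (\<i> * \<nu> * z) / (\<i> * \<nu>)"
    have "(?F has_field_derivative exp (\<i> * \<nu> * z)) (at z)" for z
      using False by (auto intro!: derivative_eq_intros)
    then have "((\<lambda>t. ?F (of_real t)) has_vector_derivative exp (\<i> * \<nu> * of_real t)) (at t within {0..T})" for t
      by (intro has_vector_derivative_real_field)
    then have "((\<lambda>t. exp (\<i> * \<nu> * of_real t)) has_integral ?F (of_real T) - ?F (of_real 0)) {0..T}"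
      using T by (intro fundamental_theorem_of_calculus) auto
    then have *: "integral {0..T} (\<lambda>t. cis (\<nu> * t)) = (cis (\<nu> * T) - 1) / (\<i> * \<nu>)"
      by (simp add: cis_conv_exp mult.assoc diff_divide_distrib integral_unique)
    have "norm (cis (\<nu> * T) - 1) \<le> 2"
      using norm_triangle_ineq4[of "cis (\<nu> * T)" 1] by simp
    then show ?thesis
      using T False by (simp add: time_average_def * norm_divide norm_mult divide_simps)
  qed
  then have "\<forall>\<^sub>F T in at_top. norm (time_average T (\<lambda>t. cis (\<nu> * t))) \<le> (2 / \<bar>\<nu>\<bar>) / T"
    by (intro eventually_mono[OF eventually_gt_at_top[of 0]])
  moreover have "((\<lambda>T. (2 / \<bar>\<nu>\<bar>) / T) \<longlongrightarrow> 0) at_top"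
    by (rule real_tendsto_divide_at_top[OF tendsto_const filterlim_ident])
  ultimately show ?thesis
    using False by (auto intro: Lim_null_comparison)
qed

text \<open>Averaging removes every block with a nonzero gap. Since the energies are distinct, a gap
  vanishes only when both indices agree, so the limit is the dephased initial state.\<close>

lemma equilibrium_state_spectral:
  fixes \<rho>0 :: "'n::finite operator"
  assumes sd: "spectral_decomposition H d E P"
  shows "equilibrium_state H \<rho>0 = (\<Sum>(i, j)\<in>{1..d} \<times> {1..d}. if i = j then P j ** \<rho>0 ** P i else 0)"
proof -
  have avg: "time_average T (evolved_state H \<rho>0) =
      (\<Sum>(i, j)\<in>{1..d} \<times> {1..d}. mat_scale (time_average T (\<lambda>t. cis ((E i - E j) * t))) (P j ** \<rho>0 ** P i))" for T
  proof -
    have int: "((\<lambda>t. mat_scale (cis (\<nu> * t)) B) has_integral mat_scale (integral {0..T} (\<lambda>t. cis (\<nu> * t))) B) {0..T}"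
      for \<nu> and B :: "'n operator"
      using has_integral_linear[OF integrable_integral mat_scale.bounded_linear_left, of "\<lambda>t. cis (\<nu> * t)" "{0..T}" B]
      by (simp add: o_def integrable_continuous_interval continuous_intros)
    have "((\<lambda>t. evolved_state H \<rho>0 t) has_integral
      (\<Sum>(i, j)\<in>{1..d} \<times> {1..d}. mat_scale (integral {0..T} (\<lambda>t. cis ((E i - E j) * t))) (P j ** \<rho>0 ** P i))) {0..T}"
      unfolding evolved_state_spectral[OF sd] case_prod_beta by (intro has_integral_sum int) auto
    then show ?thesis
      by (simp add: time_average_def integral_unique scaleR_sum_right mat_scale.scaleR_left case_prod_beta)
  qed
  have "((\<lambda>T. time_average T (evolved_state H \<rho>0)) \<longlongrightarrow>
      (\<Sum>(i, j)\<in>{1..d} \<times> {1..d}. mat_scale (if E i - E j = 0 then 1 else 0) (P j ** \<rho>0 ** P i))) at_top"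
    unfolding avg case_prod_beta
    by (intro tendsto_sum bounded_linear.tendsto[OF mat_scale.bounded_linear_left] time_average_cis_tendsto)
  then have "equilibrium_state H \<rho>0 =
      (\<Sum>(i, j)\<in>{1..d} \<times> {1..d}. mat_scale (if E i - E j = 0 then 1 else 0) (P j ** \<rho>0 ** P i))"
    unfolding equilibrium_state_def by (intro tendsto_Lim) auto
  also have "\<dots> = (\<Sum>(i, j)\<in>{1..d} \<times> {1..d}. if i = j then P j ** \<rho>0 ** P i else 0)"
    using inj_onD[OF spectral_decompositionD(1)[OF sd]]
    by (intro sum.cong refl) (auto simp: mat_scale_one mat_scale.zero_left)
  finally show ?thesis .
qed

subsection \<open>Mean square of trigonometric polynomials\<close>

text \<open>The two-sided weight \<open>exp (- c * \<bar>t\<bar>)\<close> is folded onto the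
  half-line, which accounts for the factor 2; the second summand is the boundary term at
  \<open>R\<close>.\<close>

lemma two_sided_exp_has_integral:
  fixes c \<nu> R :: real
  assumes "c > 0" "R \<ge> 0"
  shows "((\<lambda>t. exp (- c * t) * (2 * cos (\<nu> * t))) has_integral
    2 * c / (c\<^sup>2 + \<nu>\<^sup>2) + exp (- c * R) * (2 * (\<nu> * sin (\<nu> * R) - c * cos (\<nu> * R)) / (c\<^sup>2 + \<nu>\<^sup>2))) {0..R}"
proof -
  let ?F = "\<lambda>t. exp (- c * t) * (2 * (\<nu> * sin (\<nu> * t) - c * cos (\<nu> * t)) / (c\<^sup>2 + \<nu>\<^sup>2))"
  have pos: "c\<^sup>2 + \<nu>\<^sup>2 > 0" using assms by (simp add: add_pos_nonneg)
  have "(?F has_real_derivative exp (- c * t) * (2 * cos (\<nu> * t))) (at t within {0..R})" for t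
    using pos by (auto intro!: derivative_eq_intros simp: divide_simps; simp add: algebra_simps power2_eq_square)
  then have "((\<lambda>t. exp (- c * t) * (2 * cos (\<nu> * t))) has_integral ?F R - ?F 0) {0..R}"
    using assms by (intro fundamental_theorem_of_calculus) (auto simp: has_real_derivative_iff_has_vector_derivative)
  then show ?thesis by (simp add: field_simps)
qed

text \<open>The boundary term is a bounded oscillation times a decaying exponential. What remains is
  the Fourier transform of the two-sided exponential, a Lorentzian in \<nu>.\<close>

lemma two_sided_exp_integral_tendsto:
  fixes c \<nu> :: real
  assumes "c > 0"
  shows "((\<lambda>R. integral {0..R} (\<lambda>t. exp (- c * t) * (2 * cos (\<nu> * t)))) \<longlongrightarrow> 2 * c / (c\<^sup>2 + \<nu>\<^sup>2)) at_top"
proof -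
  let ?g = "\<lambda>R. 2 * (\<nu> * sin (\<nu> * R) - c * cos (\<nu> * R)) / (c\<^sup>2 + \<nu>\<^sup>2)"
  have lim: "((\<lambda>R. exp (- c * R)) \<longlongrightarrow> 0) at_top"
    using assms by (intro filterlim_compose[OF exp_at_bot]) 
      (auto simp: filterlim_uminus_at_bot intro!: filterlim_tendsto_pos_mult_at_top[OF tendsto_const] filterlim_ident)
  let ?B = "2 * (\<bar>\<nu>\<bar> + \<bar>c\<bar>) / (c\<^sup>2 + \<nu>\<^sup>2)"
  have "norm (exp (- c * R) * ?g R) \<le> exp (- c * R) * ?B" for R
  proof -
    have "\<bar>\<nu> * sin (\<nu> * R) - c * cos (\<nu> * R)\<bar> \<le> \<bar>\<nu> * sin (\<nu> * R)\<bar> + \<bar>c * cos (\<nu> * R)\<bar>" by linarith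
    also have "\<dots> \<le> \<bar>\<nu>\<bar> * 1 + \<bar>c\<bar> * 1"
      unfolding abs_mult by (intro add_mono mult_left_mono) auto
    finally have "\<bar>?g R\<bar> \<le> ?B"
      by (simp add: abs_mult divide_right_mono)
    from mult_left_mono[OF this, of "exp (- c * R)"] show ?thesis
      by (simp only: real_norm_def abs_mult[of "exp _"] abs_exp_cancel exp_ge_zero)
  qed
  then have "((\<lambda>R. exp (- c * R) * ?g R) \<longlongrightarrow> 0) at_top"
    by (intro Lim_null_comparison[OF always_eventually tendsto_mult_left_zero[OF lim]]) blast
  then have "((\<lambda>R. 2 * c / (c\<^sup>2 + \<nu>\<^sup>2) + exp (- c * R) * ?g R) \<longlongrightarrow> 2 * c / (c\<^sup>2 + \<nu>\<^sup>2) + 0) at_top"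
    by (intro tendsto_add tendsto_const)
  moreover have "\<forall>\<^sub>F R in at_top. 2 * c / (c\<^sup>2 + \<nu>\<^sup>2) + exp (- c * R) * ?g R =
      integral {0..R} (\<lambda>t. exp (- c * t) * (2 * cos (\<nu> * t)))"
    using eventually_ge_at_top[of 0]
    by (rule eventually_mono) (rule integral_unique[OF two_sided_exp_has_integral[OF assms], symmetric])
  ultimately show ?thesis
    by (simp only: add_0_right) (rule Lim_transform_eventually)
qed

section \<open>Lorentzian sums and the counting of gaps\<close>

text \<open>Layer-cake: \<open>1 / (1 + u^2)\<close> is the integral from
  \<open>\<bar>u\<bar>\<close> to infinity of \<open>h\<close>, which is minus the derivative of
  \<open>1 / (1 + r^2)\<close>. Summing over \<open>a\<close> under the integral produces the
  counting function, and the assumed count integrates to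
  \<open>N * (1 + pi / (2 * \<delta>))\<close>.\<close>

lemma lorentzian_sum_bound:
  fixes u :: "'a \<Rightarrow> real" and \<delta> N :: real
  assumes "finite A" and "\<delta> > 0" and "N \<ge> 0"
    and count: "\<And>r. r \<ge> 0 \<Longrightarrow> real (card {a \<in> A. \<bar>u a\<bar> \<le> r}) \<le> N * (1 + r / \<delta>)"
  shows "(\<Sum>a\<in>A. 1 / (1 + (u a)\<^sup>2)) \<le> N * (1 + pi / (2 * \<delta>))"
proof -
  define h where "h r = 2 * r / (1 + r\<^sup>2)\<^sup>2" for r :: real
  have pos: "1 + r\<^sup>2 > 0" for r :: real
    by (simp add: add_pos_nonneg)
  have dg: "((\<lambda>r. - (1 / (1 + r\<^sup>2))) has_real_derivative h r) (at r within S)" for r S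
    unfolding h_def using pos[of r] by (auto intro!: derivative_eq_intros simp: power2_eq_square)
  \<comment> \<open>Antiderivative found by integration by parts; the arctangent, at most
    \<open>pi / 2\<close>, is the source of \<open>pi\<close>.\<close>
  have dG: "((\<lambda>r. - ((1 + r / \<delta>) / (1 + r\<^sup>2)) + arctan r / \<delta>) has_real_derivative
      (1 + r / \<delta>) * h r) (at r within S)" for r S
  proof -
    have "((\<lambda>r. - ((1 + r / \<delta>) / (1 + r\<^sup>2)) + arctan r / \<delta>) has_real_derivative
        - ((1 / \<delta> * (1 + r\<^sup>2) - (1 + r / \<delta>) * (2 * r)) / (1 + r\<^sup>2)\<^sup>2) + 1 / (1 + r\<^sup>2) / \<delta>) (at r within S)"
      using pos[of r] \<open>\<delta> > 0\<close> by (auto intro!: derivative_eq_intros simp: power2_eq_square inverse_eq_divide)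
    also have "- ((1 / \<delta> * (1 + r\<^sup>2) - (1 + r / \<delta>) * (2 * r)) / (1 + r\<^sup>2)\<^sup>2) + 1 / (1 + r\<^sup>2) / \<delta> = (1 + r / \<delta>) * h r"
      unfolding h_def using pos[of r] \<open>\<delta> > 0\<close> by (simp add: divide_simps) (simp add: algebra_simps power2_eq_square)
    finally show ?thesis .
  qed
  have intg: "(h has_integral (1 / (1 + x\<^sup>2) - 1 / (1 + R\<^sup>2))) {x..R}" if "x \<le> R" for x R
    using fundamental_theorem_of_calculus[OF that, of "\<lambda>r. - (1 / (1 + r\<^sup>2))" h] dg
    by (simp add: has_real_derivative_iff_has_vector_derivative)
  have intG: "((\<lambda>r. (1 + r / \<delta>) * h r) has_integral
      (- ((1 + R / \<delta>) / (1 + R\<^sup>2)) + arctan R / \<delta> + 1)) {0..R}" if "0 \<le> R" for R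
    using fundamental_theorem_of_calculus[OF that, OF dG[unfolded has_real_derivative_iff_has_vector_derivative]]
    by simp
  \<comment> \<open>A finite cutoff \<open>R\<close> beyond all \<open>\<bar>u a\<bar>\<close> keeps
    the integrals on compact intervals; its cost, \<open>1 / (1 + R^2)\<close> for each element,
    disappears as \<open>R\<close> grows.\<close>
  have bound: "(\<Sum>a\<in>A. 1 / (1 + (u a)\<^sup>2)) \<le> real (card A) / (1 + R\<^sup>2) + N * (1 + pi / (2 * \<delta>))"
    if R: "R \<ge> 0" "\<forall>a\<in>A. \<bar>u a\<bar> \<le> R" for R
  proof -
    have ind: "((\<lambda>r. if \<bar>u a\<bar> \<le> r then h r else 0) has_integral (1 / (1 + (u a)\<^sup>2) - 1 / (1 + R\<^sup>2))) {0..R}"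
      if "a \<in> A" for a
    proof -
      have *: "{0..R} \<inter> {r. \<bar>u a\<bar> \<le> r} = {\<bar>u a\<bar>..R}" by auto
      show ?thesis
        using intg[of "\<bar>u a\<bar>" R] R that
        by (subst has_integral_restrict_Int[of "{r. \<bar>u a\<bar> \<le> r}" h, simplified mem_Collect_eq]) (simp add: * Int_commute)
    qed
    have "((\<lambda>r. \<Sum>a\<in>A. if \<bar>u a\<bar> \<le> r then h r else 0) has_integral
        (\<Sum>a\<in>A. 1 / (1 + (u a)\<^sup>2) - 1 / (1 + R\<^sup>2))) {0..R}"
      using ind by (intro has_integral_sum \<open>finite A\<close>)
    moreover have "((\<lambda>r. N * ((1 + r / \<delta>) * h r)) has_integral
        N * (- ((1 + R / \<delta>) / (1 + R\<^sup>2)) + arctan R / \<delta> + 1)) {0..R}"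
      using intG R by (intro has_integral_mult_right) auto
    ultimately have "(\<Sum>a\<in>A. 1 / (1 + (u a)\<^sup>2) - 1 / (1 + R\<^sup>2)) \<le>
        N * (- ((1 + R / \<delta>) / (1 + R\<^sup>2)) + arctan R / \<delta> + 1)"
    proof (rule has_integral_le)
      fix r assume r: "r \<in> {0..R}"
      have "(\<Sum>a\<in>A. if \<bar>u a\<bar> \<le> r then h r else 0) = real (card {a \<in> A. \<bar>u a\<bar> \<le> r}) * h r"
        using \<open>finite A\<close> by (simp add: sum.If_cases Int_def)
      also have "\<dots> \<le> N * (1 + r / \<delta>) * h r"
        using r by (intro mult_right_mono count) (auto simp: h_def)
      finally show "(\<Sum>a\<in>A. if \<bar>u a\<bar> \<le> r then h r else 0) \<le> N * ((1 + r / \<delta>) * h r)" by simp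
    qed
    also have "\<dots> \<le> N * (1 + pi / (2 * \<delta>))"
    proof (rule mult_left_mono[OF _ \<open>N \<ge> 0\<close>])
      have "arctan R / \<delta> \<le> (pi / 2) / \<delta>"
        using arctan_ubound[of R] \<open>\<delta> > 0\<close> by (intro divide_right_mono) auto
      moreover have "(1 + R / \<delta>) / (1 + R\<^sup>2) \<ge> 0"
        using R \<open>\<delta> > 0\<close> pos[of R] by simp
      ultimately show "- ((1 + R / \<delta>) / (1 + R\<^sup>2)) + arctan R / \<delta> + 1 \<le> 1 + pi / (2 * \<delta>)"
        by simp
    qed
    finally show ?thesis
      by (simp add: sum_subtractf)
  qed
  have "((\<lambda>R::real. real (card A) / (1 + R\<^sup>2)) \<longlongrightarrow> 0) at_top"
    by (intro real_tendsto_divide_at_top tendsto_const filterlim_tendsto_add_at_top[OF tendsto_const]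
        filterlim_pow_at_top filterlim_ident) auto
  then have "((\<lambda>R::real. real (card A) / (1 + R\<^sup>2) + N * (1 + pi / (2 * \<delta>))) \<longlongrightarrow> 0 + N * (1 + pi / (2 * \<delta>))) at_top"
    by (intro tendsto_add tendsto_const)
  then have "(\<Sum>a\<in>A. 1 / (1 + (u a)\<^sup>2)) \<le> 0 + N * (1 + pi / (2 * \<delta>))"
  proof (rule tendsto_lowerbound)
    have "\<forall>\<^sub>F R in at_top. R \<ge> 0 \<and> (\<forall>a\<in>A. \<bar>u a\<bar> \<le> R)"
      using \<open>finite A\<close> by (intro eventually_conj eventually_ge_at_top eventually_ball_finite ballI)
    then show "\<forall>\<^sub>F R in at_top. (\<Sum>a\<in>A. 1 / (1 + (u a)\<^sup>2)) \<le> real (card A) / (1 + R\<^sup>2) + N * (1 + pi / (2 * \<delta>))"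
      by (rule eventually_mono) (use bound in auto)
  qed simp
  then show ?thesis by simp
qed

text \<open>A closed interval of length \<open>2 * r\<close> is covered by consecutive half-open
  windows of length \<open>\<epsilon>\<close> starting at its left end.\<close>

lemma card_within_le:
  fixes g :: "'a \<Rightarrow> real" and N :: nat
  assumes "finite A" "\<epsilon> > 0" "r \<ge> 0"
    and count: "\<And>x. card {a \<in> A. g a \<in> {x..<x + \<epsilon>}} \<le> N"
  shows "real (card {a \<in> A. \<bar>g a - y\<bar> \<le> r}) \<le> real N * (1 + 2 * r / \<epsilon>)"
proof -
  \<comment> \<open>The windows are numbered from \<open>0\<close> to \<open>K\<close>, so there are
    \<open>K + 1\<close>: when \<open>2 * r\<close> is a multiple of \<open>\<epsilon>\<close>, the
    closed right endpoint opens a window of its own.\<close>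
  define K where "K = nat \<lfloor>2 * r / \<epsilon>\<rfloor>"
  define B where "B k = {a \<in> A. g a \<in> {y - r + real k * \<epsilon>..<y - r + real k * \<epsilon> + \<epsilon>}}" for k
  have "{a \<in> A. \<bar>g a - y\<bar> \<le> r} \<subseteq> (\<Union>k\<le>K. B k)"
  proof
    fix a assume a: "a \<in> {a \<in> A. \<bar>g a - y\<bar> \<le> r}"
    define q where "q = (g a - (y - r)) / \<epsilon>"
    have ga: "g a = y - r + q * \<epsilon>" using \<open>\<epsilon> > 0\<close> by (simp add: q_def)
    have q: "0 \<le> q" "q \<le> 2 * r / \<epsilon>"
      using a \<open>\<epsilon> > 0\<close> by (auto simp: q_def divide_right_mono)
    have k: "real (nat \<lfloor>q\<rfloor>) \<le> q" "q < real (nat \<lfloor>q\<rfloor>) + 1"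
      using q by linarith+
    have "real (nat \<lfloor>q\<rfloor>) * \<epsilon> \<le> q * \<epsilon>" "q * \<epsilon> < (real (nat \<lfloor>q\<rfloor>) + 1) * \<epsilon>"
      using k \<open>\<epsilon> > 0\<close> by (simp_all add: mult_right_mono)
    then have "a \<in> B (nat \<lfloor>q\<rfloor>)"
      using a unfolding B_def by (simp add: ga algebra_simps)
    moreover have "nat \<lfloor>q\<rfloor> \<le> K"
      using q by (simp add: K_def nat_mono floor_mono)
    ultimately show "a \<in> (\<Union>k\<le>K. B k)" by blast
  qed
  then have "card {a \<in> A. \<bar>g a - y\<bar> \<le> r} \<le> card (\<Union>k\<le>K. B k)"
    using \<open>finite A\<close> by (intro card_mono) (auto simp: B_def)
  also have "\<dots> \<le> (\<Sum>k\<le>K. card (B k))"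
    by (rule card_UN_le) simp
  also have "\<dots> \<le> (\<Sum>k\<le>K. N)"
    unfolding B_def by (intro sum_mono count)
  finally have "card {a \<in> A. \<bar>g a - y\<bar> \<le> r} \<le> Suc K * N" by simp
  then have "real (card {a \<in> A. \<bar>g a - y\<bar> \<le> r}) \<le> real (Suc K * N)"
    by (simp only: of_nat_le_iff)
  also have "\<dots> = real N * (1 + real K)" by (simp add: algebra_simps)
  also have "\<dots> \<le> real N * (1 + 2 * r / \<epsilon>)"
  proof (intro mult_left_mono add_left_mono)
    have "2 * r / \<epsilon> \<ge> 0" using assms by simp
    then show "real K \<le> 2 * r / \<epsilon>" unfolding K_def by linarith
  qed simp
  finally show ?thesis .
qed

text \<open>Comparing ninth powers reduces this to \<open>e^2 \<le> 2.72^2 \<le> 1.25^9\<close>. The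
  exponent is the later value of \<open>c * T / 2\<close>.\<close>

lemma exp_two_ninths_le: "exp (2 / 9 :: real) \<le> 5 / 4"
proof (rule power_le_imp_le_base)
  have "exp (2 / 9 :: real) ^ Suc 8 = exp 1 ^ 2"
    by (simp add: exp_of_nat_mult[symmetric] del: power_Suc)
  also have "\<dots> \<le> (272 / 100) ^ 2"
    using e_less_272 by (intro power_mono) auto
  also have "\<dots> \<le> (5 / 4 :: real) ^ Suc 8" by (simp add: power_divide)
  finally show "exp (2 / 9 :: real) ^ Suc 8 \<le> (5 / 4) ^ Suc 8" .
qed simp

section \<open>The weighted mean square\<close>

text \<open>Adding the values at \<open>t\<close> and \<open>- t\<close> turns each phase into twice
  a cosine, which is the form in which the half-line integrals against the weight are known.\<close>

lemma trig_poly_norm_square_even_part: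
  fixes w :: "'a \<Rightarrow> complex" and g :: "'a \<Rightarrow> real"
  shows "(cmod (\<Sum>a\<in>A. w a * cis (g a * t)))\<^sup>2 + (cmod (\<Sum>a\<in>A. w a * cis (g a * - t)))\<^sup>2 =
    (\<Sum>a\<in>A. \<Sum>b\<in>A. Re (w a * cnj (w b)) * (2 * cos ((g a - g b) * t)))"
proof -
  have sq: "complex_of_real ((cmod (\<Sum>a\<in>A. w a * cis (g a * t)))\<^sup>2) =
      (\<Sum>a\<in>A. \<Sum>b\<in>A. w a * cnj (w b) * cis ((g a - g b) * t))" for t
  proof -
    have *: "w a * cis (g a * t) * cnj (w b * cis (g b * t)) = w a * cnj (w b) * cis ((g a - g b) * t)" for a b
      by (simp add: cis_cnj cis_mult left_diff_distrib)
    show ?thesis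
      by (simp only: complex_norm_square cnj_sum sum_product *)
  qed
  have cis2: "cis x + cis (- x) = complex_of_real (2 * cos x)" for x
    by (simp add: complex_eq_iff)
  have "complex_of_real ((cmod (\<Sum>a\<in>A. w a * cis (g a * t)))\<^sup>2 + (cmod (\<Sum>a\<in>A. w a * cis (g a * - t)))\<^sup>2) =
      (\<Sum>a\<in>A. \<Sum>b\<in>A. w a * cnj (w b) * complex_of_real (2 * cos ((g a - g b) * t)))"
    unfolding of_real_add sq by (simp only: sum.distrib[symmetric] distrib_left[symmetric] mult_minus_right cis2)
  from arg_cong[OF this, of Re] show ?thesis
    by simp
qed

lemma trig_poly_mean_square:
  fixes v :: "'a \<Rightarrow> complex" and g :: "'a \<Rightarrow> real" and N :: nat
  assumes A: "finite A" and "\<epsilon> > 0" "T > 0"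
    and count: "\<And>x. card {a \<in> A. g a \<in> {x..<x + \<epsilon>}} \<le> N"
  shows "integral {0..T} (\<lambda>t. (cmod (\<Sum>a\<in>A. v a * cis (g a * t)))\<^sup>2) \<le>
    T * (5 * pi / 2 * real N * (3 / 4 + 1 / (\<epsilon> * T))) * (\<Sum>a\<in>A. (cmod (v a))\<^sup>2)"
proof -
  define c where "c = 4 / (9 * T)"
  have c: "c > 0" using \<open>T > 0\<close> by (simp add: c_def)
  \<comment> \<open>Absorbing the phase at time \<open>T / 2\<close> recentres the interval at 0
    without changing the moduli of the amplitudes.\<close>
  define w where "w a = v a * cis (g a * (T / 2))" for a
  define F where "F t = (cmod (\<Sum>a\<in>A. w a * cis (g a * t)))\<^sup>2" for t
  define K where "K a b = 2 * c / (c\<^sup>2 + (g a - g b)\<^sup>2)" for a b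
  have cont: "continuous_on S (\<lambda>t. F (f t))" if "continuous_on S f" for S :: "real set" and f
    unfolding F_def by (intro continuous_intros that)
  have int0: "(\<lambda>t. exp (- c * t) * (F t + F (- t))) integrable_on {x..y}" for x y
    by (intro integrable_continuous_interval continuous_intros cont)
  have w: "cmod (w a) = cmod (v a)" for a by (simp add: w_def norm_mult)
  have "integral {0..T} (\<lambda>t. (cmod (\<Sum>a\<in>A. v a * cis (g a * t)))\<^sup>2) = integral {0..T} (\<lambda>t. F (t - T / 2))"
    by (intro integral_cong) (simp add: F_def w_def mult.assoc cis_mult algebra_simps)
  also have "\<dots> = integral {- (T / 2)..T / 2} F"
  proof -
    have "(F has_integral integral {- (T / 2)..T / 2} F) {- (T / 2)..T / 2}"
      by (intro integrable_integral integrable_continuous_interval cont[of _ "\<lambda>t. t", simplified] continuous_intros)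
    then have "((\<lambda>t. F (t + - (T / 2))) has_integral integral {- (T / 2)..T / 2} F)
        {- (T / 2) - - (T / 2)..T / 2 - - (T / 2)}"
      by (rule has_integral_shift_real_ivl)
    then show ?thesis by (simp add: integral_unique)
  qed
  also have "\<dots> = integral {- (T / 2)..0} F + integral {0..T / 2} F"
    using \<open>T > 0\<close>
    by (intro Henstock_Kurzweil_Integration.integral_combine[symmetric] integrable_continuous_interval
        cont[of _ "\<lambda>t. t", simplified])
      (auto intro: continuous_intros)
  also have "integral {- (T / 2)..0} F = integral {0..T / 2} (\<lambda>t. F (- t))"
    using Henstock_Kurzweil_Integration.integral_reflect_real[of "T / 2" 0 "\<lambda>t. F (- t)"] by simp
  also have "integral {0..T / 2} (\<lambda>t. F (- t)) + integral {0..T / 2} F = integral {0..T / 2} (\<lambda>t. F t + F (- t))"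
    by (subst integral_add) (auto intro!: integrable_continuous_interval cont continuous_intros)
  finally have eq: "integral {0..T} (\<lambda>t. (cmod (\<Sum>a\<in>A. v a * cis (g a * t)))\<^sup>2) =
      integral {0..T / 2} (\<lambda>t. F t + F (- t))" .

  \<comment> \<open>Inserting the weight costs at most \<open>5 / 4\<close> on
    \<open>[0, T / 2]\<close>; as the weighted integrand is nonnegative, the range may then be
    extended to any \<open>R\<close>, and later to infinity.\<close>
  have le: "integral {0..T / 2} (\<lambda>t. F t + F (- t)) \<le>
      5 / 4 * integral {0..R} (\<lambda>t. exp (- c * t) * (F t + F (- t)))" if "R \<ge> T / 2" for R
  proof -
    have "integral {0..T / 2} (\<lambda>t. F t + F (- t)) \<le> integral {0..T / 2} (\<lambda>t. 5 / 4 * (exp (- c * t) * (F t + F (- t))))"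
    proof (rule integral_le)
      fix t assume t: "t \<in> {0..T / 2}"
      have "c * t \<le> c * (T / 2)" using t c by (intro mult_left_mono) auto
      also have "\<dots> = 2 / 9" using \<open>T > 0\<close> by (simp add: c_def)
      finally have "exp (c * t) \<le> 5 / 4"
        using exp_two_ninths_le order_trans[of "exp (c * t)" "exp (2 / 9)" "5 / 4"] by simp
      then have "1 \<le> 5 / 4 * exp (- c * t)" by (simp add: exp_minus divide_simps)
      from mult_right_mono[OF this, of "F t + F (- t)"]
      show "F t + F (- t) \<le> 5 / 4 * (exp (- c * t) * (F t + F (- t)))" by (simp add: F_def)
    qed (auto intro!: integrable_continuous_interval cont continuous_intros)
    also have "\<dots> = 5 / 4 * integral {0..T / 2} (\<lambda>t. exp (- c * t) * (F t + F (- t)))"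
      by simp
    also have "\<dots> \<le> 5 / 4 * integral {0..R} (\<lambda>t. exp (- c * t) * (F t + F (- t)))"
      using that int0 by (intro mult_left_mono integral_subset_le) (auto simp: F_def)
    finally show ?thesis .
  qed

  have "integral {0..R} (\<lambda>t. exp (- c * t) * (F t + F (- t))) =
      (\<Sum>a\<in>A. \<Sum>b\<in>A. Re (w a * cnj (w b)) * integral {0..R} (\<lambda>t. exp (- c * t) * (2 * cos ((g a - g b) * t))))" for R
  proof -
    have "integral {0..R} (\<lambda>t. exp (- c * t) * (F t + F (- t))) =
      integral {0..R} (\<lambda>t. \<Sum>a\<in>A. \<Sum>b\<in>A. Re (w a * cnj (w b)) * (exp (- c * t) * (2 * cos ((g a - g b) * t))))"
      unfolding F_def trig_poly_norm_square_even_part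
      by (simp only: sum_distrib_left mult.left_commute)
    also have "\<dots> = (\<Sum>a\<in>A. \<Sum>b\<in>A. integral {0..R}
        (\<lambda>t. Re (w a * cnj (w b)) * (exp (- c * t) * (2 * cos ((g a - g b) * t)))))"
      using A
      by (subst integral_sum, simp, intro integrable_continuous_interval continuous_intros sum.cong refl)
        (subst integral_sum, simp, intro integrable_continuous_interval continuous_intros, rule refl)
    finally show ?thesis by simp
  qed
  then have "((\<lambda>R. 5 / 4 * integral {0..R} (\<lambda>t. exp (- c * t) * (F t + F (- t)))) \<longlongrightarrow>
      5 / 4 * (\<Sum>a\<in>A. \<Sum>b\<in>A. Re (w a * cnj (w b)) * K a b)) at_top"
    unfolding K_def by (simp only:) (intro tendsto_intros two_sided_exp_integral_tendsto c)
  then have "integral {0..T / 2} (\<lambda>t. F t + F (- t)) \<le> 5 / 4 * (\<Sum>a\<in>A. \<Sum>b\<in>A. Re (w a * cnj (w b)) * K a b)"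
    by (rule tendsto_lowerbound) (use eventually_ge_at_top[of "T / 2"] le in \<open>auto elim: eventually_mono\<close>)
  \<comment> \<open>Schur test again: nonnegativity of the Lorentzian kernel \<open>K\<close> allows
    products of amplitudes to be replaced by half squares, and its symmetry then leaves only row
    sums.\<close>
  also have "(\<Sum>a\<in>A. \<Sum>b\<in>A. Re (w a * cnj (w b)) * K a b) \<le>
      (\<Sum>a\<in>A. \<Sum>b\<in>A. ((cmod (v a))\<^sup>2 / 2 + (cmod (v b))\<^sup>2 / 2) * K a b)"
  proof (intro sum_mono mult_right_mono)
    fix a b
    have "Re (w a * cnj (w b)) \<le> cmod (w a * cnj (w b))" by (rule complex_Re_le_cmod)
    also have "\<dots> = cmod (v a) * cmod (v b)" by (simp add: norm_mult w)
    also have "\<dots> \<le> (cmod (v a))\<^sup>2 / 2 + (cmod (v b))\<^sup>2 / 2"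
      using sum_squares_bound[of "cmod (v a)" "cmod (v b)"] by simp
    finally show "Re (w a * cnj (w b)) \<le> (cmod (v a))\<^sup>2 / 2 + (cmod (v b))\<^sup>2 / 2" .
    show "K a b \<ge> 0" using c by (simp add: K_def)
  qed
  also have "\<dots> = (\<Sum>a\<in>A. (cmod (v a))\<^sup>2 * (\<Sum>b\<in>A. K b a))"
  proof -
    have K: "K a b = K b a" for a b by (simp add: K_def power2_commute)
    have "(\<Sum>a\<in>A. \<Sum>b\<in>A. (cmod (v b))\<^sup>2 / 2 * K a b) = (\<Sum>a\<in>A. \<Sum>b\<in>A. (cmod (v a))\<^sup>2 / 2 * K a b)"
      by (subst sum.swap) (simp only: K)
    then have "(\<Sum>a\<in>A. \<Sum>b\<in>A. ((cmod (v a))\<^sup>2 / 2 + (cmod (v b))\<^sup>2 / 2) * K a b) =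
        2 * (\<Sum>a\<in>A. \<Sum>b\<in>A. (cmod (v a))\<^sup>2 / 2 * K a b)"
      by (simp only: distrib_right sum.distrib)
    then show ?thesis
      by (simp add: sum_distrib_left K)
  qed
  also have "\<dots> \<le> (\<Sum>a\<in>A. (cmod (v a))\<^sup>2 * (2 / c * (real N * (1 + pi * c / \<epsilon>))))"
  proof (intro sum_mono mult_left_mono)
    fix a
    have "K b a = 2 / c * (1 / (1 + ((g b - g a) / c)\<^sup>2))" for b
      using c by (simp add: K_def divide_simps power2_eq_square)
    then have "(\<Sum>b\<in>A. K b a) = 2 / c * (\<Sum>b\<in>A. 1 / (1 + ((g b - g a) / c)\<^sup>2))"
      by (simp only: sum_distrib_left)
    \<comment> \<open>Rescaled distance \<open>r\<close> means true distance \<open>r * c\<close>,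
      for which \<open>card_within_le\<close> counts \<open>1 + 2 * r * c / \<epsilon>\<close>
      windows; hence \<open>\<delta> = \<epsilon> / (2 * c)\<close>.\<close>
    also have "\<dots> \<le> 2 / c * (real N * (1 + pi / (2 * (\<epsilon> / (2 * c)))))"
    proof (intro mult_left_mono lorentzian_sum_bound A)
      fix r :: real assume r: "r \<ge> 0"
      have "{b \<in> A. \<bar>(g b - g a) / c\<bar> \<le> r} = {b \<in> A. \<bar>g b - g a\<bar> \<le> r * c}"
        using c by (simp add: abs_divide divide_simps)
      then show "real (card {b \<in> A. \<bar>(g b - g a) / c\<bar> \<le> r}) \<le> real N * (1 + r / (\<epsilon> / (2 * c)))"
        using card_within_le[OF A \<open>\<epsilon> > 0\<close> _ count, of "r * c" "g a"] r c by (simp add: mult_ac)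
    qed (use c \<open>\<epsilon> > 0\<close> in auto)
    finally show "(\<Sum>b\<in>A. K b a) \<le> 2 / c * (real N * (1 + pi * c / \<epsilon>))" by simp
  qed simp
  also have "\<dots> = T * ((9 / 2 + 2 * pi / (\<epsilon> * T)) * real N) * (\<Sum>a\<in>A. (cmod (v a))\<^sup>2)"
    using \<open>T > 0\<close> \<open>\<epsilon> > 0\<close> unfolding sum_distrib_right[symmetric] c_def by (simp add: field_simps)
  also have "5 / 4 * \<dots> = T * ((5 / 4 * (9 / 2) + 5 / 4 * (2 * pi / (\<epsilon> * T))) * real N) * (\<Sum>a\<in>A. (cmod (v a))\<^sup>2)"
    by (simp only: distrib_left distrib_right mult.assoc mult.left_commute)
  \<comment> \<open>Only the constant part is enlarged; the part in
    \<open>1 / (\<epsilon> * T)\<close> already has its final coefficient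
    \<open>5 * pi / 2\<close>.\<close>
  also have "\<dots> \<le> T * ((5 * pi / 2 * (3 / 4) + 5 / 4 * (2 * pi / (\<epsilon> * T))) * real N) * (\<Sum>a\<in>A. (cmod (v a))\<^sup>2)"
    using pi_gt3 \<open>T > 0\<close> by (intro mult_left_mono mult_right_mono add_right_mono sum_nonneg) auto
  finally show ?thesis
    unfolding eq by (simp add: algebra_simps)
qed

text \<open>Nonnegativity of the variance of \<open>f\<close> over \<open>[0, T]\<close>: the
  squared mean is at most the mean of the squares.\<close>

lemma integral_le_sqrt_mean_square:
  fixes f :: "real \<Rightarrow> real"
  assumes "T > 0" and "continuous_on {0..T} f" 
    and le: "integral {0..T} (\<lambda>t. (f t)\<^sup>2) \<le> T * B"
  shows "integral {0..T} f \<le> T * sqrt B"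
proof -
  define m where "m = integral {0..T} f / T"
  have "0 \<le> integral {0..T} (\<lambda>t. (f t - m)\<^sup>2)"
    using assms by (intro integral_nonneg integrable_continuous_interval continuous_intros) auto
  also have "\<dots> = integral {0..T} (\<lambda>t. (f t)\<^sup>2 - 2 * m * f t + m\<^sup>2)"
    by (simp add: power2_diff algebra_simps)
  also have "\<dots> = integral {0..T} (\<lambda>t. (f t)\<^sup>2) - 2 * m * integral {0..T} f + T * m\<^sup>2"
    using assms
    by (subst integral_add integral_diff; (intro integrable_continuous_interval continuous_intros)?; simp)+
  also have "\<dots> = integral {0..T} (\<lambda>t. (f t)\<^sup>2) - T * m\<^sup>2"
    using assms by (simp add: m_def power2_eq_square)
  finally have "T * m\<^sup>2 \<le> T * B" using le by simp
  then have "m \<le> sqrt B" using \<open>T > 0\<close> by (simp add: real_le_rsqrt)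
  then show ?thesis using \<open>T > 0\<close> by (simp add: m_def divide_simps mult.commute)
qed

subsection \<open>Equilibration\<close>

text \<open>The diagonal blocks are constant in time and cancel against the equilibrium state,
  leaving exactly the pairs that \<open>gap_count\<close> ranges over.\<close>

lemma trace_difference_spectral:
  fixes Q \<rho>0 :: "'n::finite operator"
  assumes sd: "spectral_decomposition H d E P"
  defines "A \<equiv> {(i, j). i \<in> {1..d} \<and> j \<in> {1..d} \<and> i \<noteq> j}"
  shows "trace (Q ** evolved_state H \<rho>0 t) - trace (Q ** equilibrium_state H \<rho>0) =
    (\<Sum>a\<in>A. trace (Q ** (P (snd a) ** \<rho>0 ** P (fst a))) * cis ((E (fst a) - E (snd a)) * t))"
proof -
  let ?v = "\<lambda>i j. trace (Q ** (P j ** \<rho>0 ** P i))"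
  have "trace (Q ** evolved_state H \<rho>0 t) - trace (Q ** equilibrium_state H \<rho>0) =
      (\<Sum>(i, j)\<in>{1..d} \<times> {1..d}. cis ((E i - E j) * t) * ?v i j) -
      (\<Sum>(i, j)\<in>{1..d} \<times> {1..d}. if i = j then ?v i j else 0)"
    unfolding evolved_state_spectral[OF sd] equilibrium_state_spectral[OF sd] case_prod_beta
      mat_mult.sum_right linear_sum[OF linear_trace] mat_scale_mult_right trace_mat_scale
    by (intro arg_cong2[where f = minus] sum.cong refl) (auto simp: linear_0[OF linear_trace])
  also have "\<dots> = (\<Sum>(i, j)\<in>{1..d} \<times> {1..d}. if i = j then 0 else ?v i j * cis ((E i - E j) * t))"
    unfolding sum_subtractf[symmetric] case_prod_beta by (intro sum.cong refl) auto
  also have "\<dots> = (\<Sum>a\<in>A. ?v (fst a) (snd a) * cis ((E (fst a) - E (snd a)) * t))"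
    by (intro sum.mono_neutral_cong_right) (auto simp: A_def)
  finally show ?thesis .
qed

text \<open>Off the diagonal \<open>Q\<close> may be replaced by \<open>Q - 1/2\<close>, half of the unitary \<open>2 Q - 1\<close>; this gains
  the factor \<open>1 / 4\<close>.\<close>

lemma sum_gap_amplitudes_le:
  fixes Q \<rho>0 :: "'n::finite operator"
  assumes sd: "spectral_decomposition H d E P" and \<rho>: "density_operator \<rho>0" and Q: "projector Q"
  defines "A \<equiv> {(i, j). i \<in> {1..d} \<and> j \<in> {1..d} \<and> i \<noteq> j}"
  shows "(\<Sum>a\<in>A. (cmod (trace (Q ** (P (snd a) ** \<rho>0 ** P (fst a)))))\<^sup>2) \<le>
    (\<Sum>n=1..d. (Re (trace (P n ** \<rho>0)))\<^sup>2) / 4"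
proof -
  define U where "U = 2 *\<^sub>R Q - mat 1"
  have Q': "mat_adjoint Q = Q" "Q ** Q = Q" using Q by (auto simp: projector_def)
  have "mat_adjoint U = U"
    unfolding U_def linear_diff[OF linear_mat_adjoint] linear_scale[OF linear_mat_adjoint]
    by (simp add: Q' mat_adjoint_mat_1)
  moreover have "U ** U = mat 1"
  proof -
    have "U ** U = 2 *\<^sub>R (2 *\<^sub>R Q - Q) - (2 *\<^sub>R Q - mat 1)"
      by (simp only: U_def Q' mat_mult.diff_left mat_mult.diff_right mat_mult.scaleR_left
          mat_mult.scaleR_right matrix_mul_lid matrix_mul_rid)
    then show ?thesis by (simp add: vec_eq_iff scaleR_conv_of_real)
  qed
  ultimately have U: "mat_adjoint U = U" "U ** U = mat 1" .
  define f where "f i j = (cmod (trace (P i ** U ** P j ** \<rho>0)))\<^sup>2" for i j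
  have amp: "(cmod (trace (Q ** (P j ** \<rho>0 ** P i))))\<^sup>2 = f i j / 4"
    if "i \<in> {1..d}" "j \<in> {1..d}" "i \<noteq> j" for i j
  proof -
    have "trace (Q ** (P j ** \<rho>0 ** P i)) = trace (P i ** Q ** P j ** \<rho>0)"
      using trace_mul_sym[of "Q ** P j ** \<rho>0" "P i"] by (simp add: matrix_mul_assoc)
    moreover have "P i ** U ** P j = 2 *\<^sub>R (P i ** Q ** P j)"
      using spectral_decomposition_orthogonal[OF sd that]
      by (simp add: U_def mat_mult.diff_left mat_mult.diff_right mat_mult.scaleR_left mat_mult.scaleR_right)
    ultimately show ?thesis
      by (simp add: f_def mat_mult.scaleR_left linear_scale[OF linear_trace] power_mult_distrib)
  qed
  have "(\<Sum>a\<in>A. (cmod (trace (Q ** (P (snd a) ** \<rho>0 ** P (fst a)))))\<^sup>2) = (\<Sum>a\<in>A. f (fst a) (snd a) / 4)"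
    by (intro sum.cong refl amp) (auto simp: A_def)
  \<comment> \<open>The diagonal is filled in with nonnegative terms so that the bound for the full
    matrix applies.\<close>
  also have "\<dots> \<le> (\<Sum>a\<in>{1..d} \<times> {1..d}. f (fst a) (snd a) / 4)"
    by (intro sum_mono2) (auto simp: A_def f_def)
  also have "\<dots> = (\<Sum>j=1..d. \<Sum>i=1..d. f i j) / 4"
    by (subst sum.swap) (simp add: sum.cartesian_product case_prod_beta sum_divide_distrib)
  also have "\<dots> \<le> (\<Sum>n=1..d. (Re (trace (P n ** \<rho>0)))\<^sup>2) / 4"
    unfolding f_def by (intro divide_right_mono sum_off_diagonal_le[OF sd \<rho> U]) auto
  finally show ?thesis .
qed

text \<open>\<open>Max\<close> is known to dominate the members only of a finite set; here every
  cardinality is bounded by the number of all index pairs.\<close>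

lemma card_gaps_le_gap_count:
  "card {a \<in> {(i, j). i \<in> {1..d} \<and> j \<in> {1..d} \<and> i \<noteq> j}. E (fst a) - E (snd a) \<in> {x..<x + \<epsilon>}} \<le> gap_count d E \<epsilon>"
proof -
  let ?G = "\<lambda>x. {(i, j). i \<in> {1..d} \<and> j \<in> {1..d} \<and> i \<noteq> j \<and> E i - E j \<in> {x..<x + \<epsilon>}}"
  have "card (?G y) \<le> card ({1..d} \<times> {1..d})" for y
    by (rule card_mono) auto
  then have "finite (range (\<lambda>x. card (?G x)))"
    by (intro finite_subset[OF _ finite_atMost]) blast
  then have "card (?G x) \<le> gap_count d E \<epsilon>"
    unfolding gap_count_def by (rule Max_ge) blast
  moreover have "{a \<in> {(i, j). i \<in> {1..d} \<and> j \<in> {1..d} \<and> i \<noteq> j}. E (fst a) - E (snd a) \<in> {x..<x + \<epsilon>}} = ?G x"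
    by auto
  ultimately show ?thesis by simp
qed

text \<open>Additivity of the integral asks for integrable summands, so integrability is carried
  along in the induction. The list form counts a repeated projector once per outcome.\<close>

lemma sum_list_integral_le:
  fixes f :: "'a \<Rightarrow> real \<Rightarrow> real"
  assumes "\<And>x. x \<in> set xs \<Longrightarrow> f x integrable_on S" and "\<And>x. x \<in> set xs \<Longrightarrow> integral S (f x) \<le> B"
  shows "(\<lambda>t. \<Sum>x\<leftarrow>xs. f x t) integrable_on S \<and> integral S (\<lambda>t. \<Sum>x\<leftarrow>xs. f x t) \<le> real (length xs) * B"
  using assms
proof (induction xs)
  case (Cons x xs)
  then have IH: "(\<lambda>t. \<Sum>x\<leftarrow>xs. f x t) integrable_on S" "integral S (\<lambda>t. \<Sum>x\<leftarrow>xs. f x t) \<le> real (length xs) * B"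
    by simp_all
  have x: "f x integrable_on S" "integral S (f x) \<le> B" using Cons.prems by simp_all
  then show ?case
    using IH by (simp add: integral_add integrable_add algebra_simps)
qed (simp add: integrable_0)

theorem theorem8p2:
  fixes H \<rho>0 :: "'n::finite operator"
    and d\<^sub>E :: nat and E :: "nat \<Rightarrow> real" and P :: "nat \<Rightarrow> 'n operator"
    and M :: "'n operator list set"
    and \<epsilon> T :: real
  assumes "spectral_decomposition H d\<^sub>E E P"
    and "density_operator \<rho>0"
    and "finite M" and "M \<noteq> {}" and "\<And>Ps. Ps \<in> M \<Longrightarrow> measurement Ps"
    and "\<epsilon> > 0" and "T > 0"
  shows "time_average T
           (\<lambda>t. distinguishability M (evolved_state H \<rho>0 t) (equilibrium_state H \<rho>0))
         \<le> real (outcome_count M) / (4 * sqrt (effective_dimension d\<^sub>E P \<rho>0)) *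
           sqrt (5 * pi / 2 * real (gap_count d\<^sub>E E \<epsilon>) * (3 / 4 + 1 / (\<epsilon> * T)))"
proof -
  note sd = assms(1)
  define A where "A = {(i, j). i \<in> {1..d\<^sub>E} \<and> j \<in> {1..d\<^sub>E} \<and> i \<noteq> j}"
  define K where "K = 5 * pi / 2 * real (gap_count d\<^sub>E E \<epsilon>) * (3 / 4 + 1 / (\<epsilon> * T))"
  define s where "s = (\<Sum>n=1..d\<^sub>E. (Re (trace (P n ** \<rho>0)))\<^sup>2)"
  define f where "f Q t = cmod (trace (Q ** evolved_state H \<rho>0 t) - trace (Q ** equilibrium_state H \<rho>0))" for Q t
  define B where "B = T * (sqrt K * sqrt s / 2)"
  have "finite A"
    by (rule finite_subset[of _ "{1..d\<^sub>E} \<times> {1..d\<^sub>E}"]) (auto simp: A_def)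
  have "K \<ge> 0" using assms(6,7) by (simp add: K_def)
  have f_eq: "f Q t = cmod (\<Sum>a\<in>A. trace (Q ** (P (snd a) ** \<rho>0 ** P (fst a))) * cis ((E (fst a) - E (snd a)) * t))"
    for Q t
    unfolding f_def A_def trace_difference_spectral[OF sd] ..
  have cont: "continuous_on S (f Q)" for S Q
    unfolding f_eq by (intro continuous_intros)
  have fQ: "integral {0..T} (f Q) \<le> B" if Q: "projector Q" for Q
  proof -
    have "integral {0..T} (\<lambda>t. (f Q t)\<^sup>2) \<le>
        T * K * (\<Sum>a\<in>A. (cmod (trace (Q ** (P (snd a) ** \<rho>0 ** P (fst a)))))\<^sup>2)"
      unfolding f_eq K_def
      by (rule trig_poly_mean_square[OF \<open>finite A\<close> assms(6,7)]) (unfold A_def, rule card_gaps_le_gap_count)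
    also have "\<dots> \<le> T * K * (s / 4)"
      using sum_gap_amplitudes_le[OF sd assms(2) Q] assms(7) \<open>K \<ge> 0\<close>
      unfolding A_def s_def by (intro mult_left_mono) auto
    finally have "integral {0..T} (f Q) \<le> T * sqrt (K * s / 4)"
      by (intro integral_le_sqrt_mean_square assms(7) cont) simp
    then show ?thesis by (simp add: B_def real_sqrt_mult real_sqrt_divide)
  qed
  \<comment> \<open>\<open>D\<close> dominates the maximum over \<open>M\<close> by the sum over all
    measurements. Each outcome then contributes at most the same \<open>B\<close>, which is how the
    total number of outcomes enters.\<close>
  define D where "D t = (\<Sum>Ps\<in>M. 1 / 2 * (\<Sum>Q\<leftarrow>Ps. f Q t))" for t
  have list: "(\<lambda>t. \<Sum>Q\<leftarrow>Ps. f Q t) integrable_on {0..T} \<and> integral {0..T} (\<lambda>t. \<Sum>Q\<leftarrow>Ps. f Q t) \<le> real (length Ps) * B"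
    if "Ps \<in> M" for Ps
    using assms(5)[OF that] by (intro sum_list_integral_le integrable_continuous_interval cont fQ)
      (auto simp: measurement_def)
  have "integral {0..T} D = (\<Sum>Ps\<in>M. 1 / 2 * integral {0..T} (\<lambda>t. \<Sum>Q\<leftarrow>Ps. f Q t))"
    unfolding D_def using list by (subst integral_sum[OF assms(3)]) auto
  also have "\<dots> \<le> (\<Sum>Ps\<in>M. 1 / 2 * (real (length Ps) * B))"
    using list by (intro sum_mono mult_left_mono) auto
  also have "\<dots> = real (outcome_count M) * B / 2"
    by (simp add: outcome_count_def sum_distrib_right sum_divide_distrib)
  finally have D: "integral {0..T} D \<le> real (outcome_count M) * B / 2" .
  have D_int: "D integrable_on {0..T}"
    unfolding D_def using list by (intro integrable_sum assms(3) integrable_on_cmult_left) auto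
  have nonneg: "(\<Sum>Q\<leftarrow>Ps. f Q t) \<ge> 0" for Ps t
    by (rule sum_list_nonneg) (auto simp: f_def)
  have le_D: "distinguishability M (evolved_state H \<rho>0 t) (equilibrium_state H \<rho>0) \<le> D t" for t
  proof -
    have "1 / 2 * (\<Sum>Q\<leftarrow>Ps. f Q t) \<le> D t" if "Ps \<in> M" for Ps
      unfolding D_def using nonneg that
      by (intro member_le_sum[of Ps M "\<lambda>Ps. 1 / 2 * (\<Sum>Q\<leftarrow>Ps. f Q t)"] assms(3)) auto
    then show ?thesis
      unfolding distinguishability_def f_def[symmetric] using assms(3,4) by (intro Max.boundedI) auto
  qed
  have "integral {0..T} (\<lambda>t. distinguishability M (evolved_state H \<rho>0 t) (equilibrium_state H \<rho>0)) \<le>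
      real (outcome_count M) * B / 2"
  \<comment> \<open>In the non-integrable case the integral is 0 by convention, and nonnegativity of
    the bound suffices.\<close>
  proof (cases "(\<lambda>t. distinguishability M (evolved_state H \<rho>0 t) (equilibrium_state H \<rho>0)) integrable_on {0..T}")
    case True
    then show ?thesis
      using D D_int le_D by (intro order_trans[OF integral_le D]) auto
  next
    case False
    have "s \<ge> 0" unfolding s_def by (intro sum_nonneg) auto
    then have "B \<ge> 0" using assms(7) \<open>K \<ge> 0\<close> by (simp add: B_def)
    then show ?thesis using False by (simp add: not_integrable_integral)
  qed
  \<comment> \<open>The \<open>1 / 4\<close> combines the \<open>1 / 2\<close> in the
    distinguishability with the \<open>1 / 2\<close> from \<open>sqrt (s / 4)\<close>; the remaining
    \<open>s\<close> is the reciprocal of the effective dimension.\<close>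
  then have "time_average T (\<lambda>t. distinguishability M (evolved_state H \<rho>0 t) (equilibrium_state H \<rho>0)) \<le>
      real (outcome_count M) * (sqrt K * sqrt s) / 4"
    using assms(7) by (simp add: time_average_def B_def field_simps)
  also have "\<dots> = real (outcome_count M) / (4 * sqrt (effective_dimension d\<^sub>E P \<rho>0)) * sqrt K"
    unfolding effective_dimension_def s_def[symmetric] by (simp add: real_sqrt_divide)
  finally show ?thesis unfolding K_def .
qed

end
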